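(* No non-negative integer of the form $4k+1$ ($k\in\mathbb{N}_0$) can be represented in the form $3l^2+3m^2+4p_n$ with $l,m,n\in\mathbb{Z}$.
   Context: $\mathbb{N}_0=\{0,1,2,\dots\}$. $p_n=n(3n+1)/2$ (generalized pentagonal numbers), $n\in\mathbb{Z}$. *)

theory Defs
  imports Main
begin

definition gen_pentagonal :: "int \<Rightarrow> int" where
  "gen_pentagonal n = n * (3 * n + 1) div 2"

text \<open>The integer division in the definition is exact.\<close>

lemma two_gen_pentagonal: "2 * gen_pentagonal n = n * (3 * n + 1)"
proof -
  have "even (n * (3 * n + 1))"
    by simp
  then show ?thesis
    unfolding gen_pentagonal_def by simp
qed

end

theory Submission
  imports Defs
begin

text \<open>Modulo 4 the pentagonal term vanishes, so a representation would force 3 * (l^2 + m^2)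
  to be 1, that is, l^2 + m^2 to be 3. By \<open>square_mod_4\<close> a sum of two squares is only
  0, 1 or 2 modulo 4.\<close>

lemma square_mod_4:
  fixes x :: int
  shows "x\<^sup>2 mod 4 = 0 \<or> x\<^sup>2 mod 4 = 1"
proof (cases "even x")
  case True
  then obtain y where "x = 2 * y" by blast
  then show ?thesis by (simp add: power2_eq_square)
next
  case False
  then obtain y where "x = 2 * y + 1" by (elim oddE)
  then have "x\<^sup>2 = 4 * (y\<^sup>2 + y) + 1"
    by (simp add: power2_eq_square algebra_simps)
  then show ?thesis by presburger
qed

theorem corollary5p13p1:
  fixes k :: nat
  shows "\<not> (\<exists>l m n :: int. int (4 * k + 1) = 3 * l\<^sup>2 + 3 * m\<^sup>2 + 4 * gen_pentagonal n)"
proof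
  assume "\<exists>l m n :: int. int (4 * k + 1) = 3 * l\<^sup>2 + 3 * m\<^sup>2 + 4 * gen_pentagonal n"
  then obtain l m n :: int
    where "int (4 * k + 1) = 3 * l\<^sup>2 + 3 * m\<^sup>2 + 4 * gen_pentagonal n"
    by blast
  then have "4 * int k + 1 = 3 * l\<^sup>2 + 3 * m\<^sup>2 + 4 * gen_pentagonal n"
    by simp
  \<comment> \<open>3 is its own inverse modulo 4; all that matters about
    \<open>gen_pentagonal n\<close> is that it is an integer.\<close>
  then have "(l\<^sup>2 + m\<^sup>2) mod 4 = 3"
    by presburger
  with square_mod_4[of l] square_mod_4[of m] show False
    \<comment> \<open>Reduces each summand modulo 4; fixing the first one as
      \<open>l\<^sup>2\<close> keeps the reversed rule from looping.\<close>
    by (auto simp flip: mod_add_eq[of "l\<^sup>2"])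
qed

end
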